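(* Let $M\in\mathrm{O}_{n_3}(\mathbb{R})$. A $\star_M$-symmetric tensor $\mathcal{A}\in\mathbb{R}_M^{n\times n}$ is $\star_M$-PSD if and only if $\mathcal{A}=\mathcal{B}\star_M\mathcal{B}^\top$ for some tensor $\mathcal{B}\in\mathbb{R}_M^{n\times r}$, where $r$ is the $\star_M$-rank of $\mathcal{A}$.
   Context: $\mathrm{O}_{n_3}(\mathbb{R})$ is the group of real orthogonal $n_3\times n_3$ matrices. A tube is an element $\mathbf{a}\in\mathbb{R}^{1\times1\times n_3}$; $\mathrm{vec}(\mathbf{a})\in\mathbb{R}^{n_3}$ has entries $\mathbf{a}_{1,1,k}$, and $\mathrm{tube}$ is the inverse of $\mathrm{vec}$; $\mathrm{diag}(v)$ is the diagonal matrix with diagonal $v$. The $\star_M$-product of tubes is $\mathbf{a}\star_M\mathbf{b}=\mathrm{tube}(M^{-1}\mathrm{diag}(M\mathrm{vec}(\mathbf{a}))M\mathrm{vec}(\mathbf{b}))$, and $\mathbb{R}_M$ is the resulting ring of tubes. $\mathbb{R}_M^{n_1\times n_2}$ denotes $\mathbb{R}^{n_1\times n_2\times n_3}$ viewed as $n_1\times n_2$ matrices of tubes $\mathcal{A}_{i,j,:}$, with product $(\mathcal{A}\star_M\mathcal{B})_{i,j,:}=\sum_\ell\mathcal{A}_{i,\ell,:}\star_M\mathcal{B}_{\ell,j,:}$; $\mathbb{R}_M^n=\mathbb{R}^{n\times1\times n_3}$. The inner product is $\langle\mathcal{A},\mathcal{B}\rangle=\sum_{i,j,k}\mathcal{A}_{i,j,k}\mathcal{B}_{i,j,k}$.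 The transpose $\mathcal{B}^\top$ is obtained by transposing each frontal slice, $(\mathcal{B}^\top)_{i,j,:}=\mathcal{B}_{j,i,:}$; $\mathcal{A}$ is $\star_M$-symmetric if $\mathcal{A}^\top=\mathcal{A}$. A symmetric $\mathcal{A}\in\mathbb{R}_M^{n\times n}$ is $\star_M$-PSD if $\langle\mathcal{X},\mathcal{A}\star_M\mathcal{X}\rangle\ge0$ for all $\mathcal{X}\in\mathbb{R}_M^n$. The transform is $\widehat{\mathcal{A}}=\mathcal{A}\times_3M$, defined by $\widehat{\mathcal{A}}_{i,j,:}=\mathrm{tube}(M\mathrm{vec}(\mathcal{A}_{i,j,:}))$. The $\star_M$-SVD $\mathcal{A}=\mathcal{U}\star_M\mathcal{S}\star_M\mathcal{V}^\top$ is formed facewise in the transform domain: for each $k$, $\widehat{\mathcal{A}}_{:,:,k}=\widehat{\mathcal{U}}_{:,:,k}\widehat{\mathcal{S}}_{:,:,k}\widehat{\mathcal{V}}_{:,:,k}^\top$ is a matrix SVD with orthogonal $\widehat{\mathcal{U}}_{:,:,k},\widehat{\mathcal{V}}_{:,:,k}$ and $\widehat{\mathcal{S}}_{:,:,k}$ diagonal with nonnegative entries in nonincreasing order. The $\star_M$-rank of $\mathcal{A}$ is the number of indices $i$ for which the tube $\mathcal{S}_{i,i,:}$ is nonzero. *)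

theory Defs
  imports "HOL-Analysis.Analysis" "Jordan_Normal_Form.Matrix"
begin

text \<open>
  A tube is a vector \<open>a :: real^'k\<close>, with \<open>n\<^sub>3 = CARD('k)\<close>; \<open>vec\<close> and \<open>tube\<close> become the identity.
  An \<open>n\<^sub>1 \<times> n\<^sub>2 \<times> n\<^sub>3\<close> tensor is a matrix of tubes, an element of \<open>carrier_mat n\<^sub>1 n\<^sub>2\<close>: its entry
  \<open>(i, j)\<close> is the tube \<open>A\<^sub>i\<^sub>j\<^sub>:\<close>. The dimensions \<open>n\<^sub>1\<close>, \<open>n\<^sub>2\<close> are numbers, not types, because one of
  them has to be a rank. Transposing every frontal slice is \<^const>\<open>transpose_mat\<close> on the matrix of tubes.
  Frontal slices are real matrices of type \<^typ>\<open>real mat\<close>.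

  Both imported libraries declare the infix for vector indexing, so \<^const>\<open>vec_nth\<close> is written out.
\<close>

type_synonym 'k tensor = "(real^'k) mat"

definition tube_diag :: "real^'k \<Rightarrow> real^'k^'k" where
  "tube_diag v = (\<chi> i j. if i = j then vec_nth v i else 0)"

definition tube_mult :: "real^'k^'k \<Rightarrow> real^'k \<Rightarrow> real^'k \<Rightarrow> real^'k" where
  "tube_mult M a b = matrix_inv M *v (tube_diag (M *v a) *v (M *v b))"

definition star_mult :: "real^'k::finite^'k \<Rightarrow> 'k tensor \<Rightarrow> 'k tensor \<Rightarrow> 'k tensor" where
  "star_mult M A B =
     mat (dim_row A) (dim_col B)
       (\<lambda>(i, j). \<Sum>l<dim_col A. tube_mult M (A $$ (i, l)) (B $$ (l, j)))"

definition tensor_inner :: "('k::finite) tensor \<Rightarrow> 'k tensor \<Rightarrow> real" where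
  "tensor_inner A B =
     (\<Sum>i<dim_row A. \<Sum>j<dim_col A. \<Sum>k\<in>UNIV. vec_nth (A $$ (i, j)) k * vec_nth (B $$ (i, j)) k)"

definition star_symmetric :: "('k::finite) tensor \<Rightarrow> bool" where
  "star_symmetric A \<longleftrightarrow> transpose_mat A = A"

definition star_psd :: "real^'k::finite^'k \<Rightarrow> 'k tensor \<Rightarrow> bool" where
  "star_psd M A \<longleftrightarrow> star_symmetric A \<and>
     (\<forall>X \<in> carrier_mat (dim_row A) 1. 0 \<le> tensor_inner X (star_mult M A X))"

definition hat :: "real^'k::finite^'k \<Rightarrow> 'k tensor \<Rightarrow> 'k tensor" where
  "hat M A = map_mat (\<lambda>a. M *v a) A"

definition frontal_slice :: "('k::finite) tensor \<Rightarrow> 'k \<Rightarrow> real mat" where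
  "frontal_slice A k = map_mat (\<lambda>a. vec_nth a k) A"

text \<open>The library's \<^const>\<open>orthogonal_mat\<close> only asks for orthogonal nonzero columns, not for
  orthonormal ones, hence the following definition.\<close>

definition real_orthogonal_mat :: "nat \<Rightarrow> real mat \<Rightarrow> bool" where
  "real_orthogonal_mat n U \<longleftrightarrow> U \<in> carrier_mat n n \<and>
     transpose_mat U * U = 1\<^sub>m n \<and> U * transpose_mat U = 1\<^sub>m n"

definition is_matrix_svd :: "real mat \<Rightarrow> real mat \<Rightarrow> real mat \<Rightarrow> real mat \<Rightarrow> bool" where
  "is_matrix_svd A U S V \<longleftrightarrow>
     real_orthogonal_mat (dim_row A) U \<and> real_orthogonal_mat (dim_col A) V \<and>
     S \<in> carrier_mat (dim_row A) (dim_col A) \<and> diagonal_mat S \<and>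
     (\<forall>i < min (dim_row A) (dim_col A). 0 \<le> S $$ (i, i)) \<and>
     (\<forall>i j. i \<le> j \<longrightarrow> j < min (dim_row A) (dim_col A) \<longrightarrow> S $$ (j, j) \<le> S $$ (i, i)) \<and>
     A = U * S * transpose_mat V"

definition is_star_svd ::
  "real^'k::finite^'k \<Rightarrow> 'k tensor \<Rightarrow> 'k tensor \<Rightarrow> 'k tensor \<Rightarrow> 'k tensor \<Rightarrow> bool" where
  "is_star_svd M A U S V \<longleftrightarrow>
     A = star_mult M (star_mult M U S) (transpose_mat V) \<and>
     (\<forall>k. is_matrix_svd (frontal_slice (hat M A) k) (frontal_slice (hat M U) k)
            (frontal_slice (hat M S) k) (frontal_slice (hat M V) k))"

text \<open>The factors of a \<open>\<star>\<^sub>M\<close>-SVD are not unique, but for invertible \<open>M\<close> the tensor \<open>S\<close>, and so the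
  number of its nonzero diagonal tubes, is: its transformed slices hold the sorted singular values.\<close>

definition star_rank :: "real^'k::finite^'k \<Rightarrow> 'k tensor \<Rightarrow> nat" where
  "star_rank M A =
     (THE r. \<exists>U S V. is_star_svd M A U S V \<and>
        r = card {i. i < min (dim_row A) (dim_col A) \<and> S $$ (i, i) \<noteq> 0})"

end

theory Submission
  imports Defs "Jordan_Normal_Form.Schur_Decomposition"
begin

text \<open>
  For orthogonal \<open>M\<close> the transform turns the \<open>\<star>\<^sub>M\<close>-product into the product of the transformed frontal
  slices and preserves the inner product, so \<open>A\<close> is \<open>\<star>\<^sub>M\<close>-PSD iff every transformed slice is a PSD
  matrix. A product \<open>B \<star>\<^sub>M B\<^sup>T\<close> is PSD slice by slice. Conversely, the spectral decompositions
  \<open>Q\<^sub>k D\<^sub>k Q\<^sub>k\<^sup>T\<close> of the slices, with sorted eigenvalues, form a \<open>\<star>\<^sub>M\<close>-SVD of \<open>A\<close>. The singular tubes that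
  do not vanish are the first \<open>r\<close> ones, \<open>r\<close> being the \<open>\<star>\<^sub>M\<close>-rank, so each \<open>D\<^sub>k\<close> vanishes beyond index \<open>r\<close>,
  and the slices of \<open>B\<close> are the first \<open>r\<close> columns of \<open>Q\<^sub>k D\<^sub>k\<^bsup>1/2\<^esup>\<close>.
  That the rank does not depend on the chosen SVD follows from the characteristic polynomials of
  \<open>X\<^sup>T X\<close> for the transformed slices \<open>X\<close>, which determine the number of zero singular values.
\<close>

unbundle no vec_syntax
unbundle no inner_syntax

section \<open>Diagonalization of real symmetric matrices\<close>

lemma real_orthogonal_matI:
  assumes "Q \<in> carrier_mat n n" "transpose_mat Q * Q = 1\<^sub>m n"
  shows "real_orthogonal_mat n Q"
  unfolding real_orthogonal_mat_def
  using assms mat_mult_left_right_inverse[of "transpose_mat Q" n Q] by auto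

lemma real_orthogonal_matD:
  assumes "real_orthogonal_mat n Q"
  shows "Q \<in> carrier_mat n n" "transpose_mat Q * Q = 1\<^sub>m n" "Q * transpose_mat Q = 1\<^sub>m n"
  using assms unfolding real_orthogonal_mat_def by auto

lemma real_orthogonal_mat_mult:
  assumes "real_orthogonal_mat n P" "real_orthogonal_mat n Q"
  shows "real_orthogonal_mat n (P * Q)"
proof (rule real_orthogonal_matI)
  note P = real_orthogonal_matD[OF assms(1)] and Q = real_orthogonal_matD[OF assms(2)]
  show "P * Q \<in> carrier_mat n n" using P Q by auto
  have "transpose_mat (P * Q) * (P * Q) = transpose_mat Q * transpose_mat P * (P * Q)"
    using transpose_mult[OF P(1) Q(1)] by simp
  also have "\<dots> = transpose_mat Q * (transpose_mat P * (P * Q))"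
    using P(1) Q(1) by (intro assoc_mult_mat) auto
  also have "transpose_mat P * (P * Q) = transpose_mat P * P * Q"
    using P(1) Q(1) by (intro assoc_mult_mat[symmetric]) auto
  finally show "transpose_mat (P * Q) * (P * Q) = 1\<^sub>m n" using P Q by simp
qed

text \<open>The matrix is real and symmetric, so it can be moved across the Hermitian product of an
  eigenvector \<open>v\<close> with itself. This yields \<open>a\<close> and \<open>cnj a\<close> as
  factors of the same nonzero number \<open>v \<bullet>c v\<close>.\<close>

lemma eigenvalue_real_symmetric:
  fixes A :: "real mat"
  assumes A: "A \<in> carrier_mat n n" and sym: "transpose_mat A = A"
    and ev: "eigenvalue (map_mat complex_of_real A) a"
  shows "a \<in> \<real>"
proof -
  let ?C = "map_mat complex_of_real A"
  have C: "?C \<in> carrier_mat n n" using A by auto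
  obtain v where v: "v \<in> carrier_vec n" "v \<noteq> 0\<^sub>v n" and Cv: "?C *\<^sub>v v = a \<cdot>\<^sub>v v"
    using ev C unfolding eigenvalue_def eigenvector_def by auto
  have cv: "conjugate v \<in> carrier_vec n" using v by auto
  have "transpose_mat ?C = map_mat complex_of_real (transpose_mat A)"
    by (simp add: map_mat_transpose)
  then have symC: "transpose_mat ?C = ?C" using sym by simp
  have conj: "?C *\<^sub>v conjugate v = conjugate (?C *\<^sub>v v)"
    using C v by (intro eq_vecI) (auto simp: scalar_prod_def cnj_sum conjugate_complex_def)
  have "a * (v \<bullet>c v) = (?C *\<^sub>v v) \<bullet>c v"
    unfolding Cv using v by simp
  also have "\<dots> = v \<bullet> (?C *\<^sub>v conjugate v)"
    using transpose_vec_mult_scalar[OF C cv v(1)] symC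
    by (metis C cv v(1) comm_scalar_prod mult_mat_vec_carrier)
  also have "\<dots> = cnj a * (v \<bullet>c v)"
    unfolding conj Cv conjugate_smult_vec using v by simp
  finally have "a = cnj a" using v by simp
  then show ?thesis by (metis Reals_cnj_iff)
qed

text \<open>Over the complex numbers the polynomial splits. Its roots are eigenvalues, hence real,
  and the factorization pulls back along the injective embedding of the reals.\<close>

lemma char_poly_real_symmetric_splits:
  fixes A :: "real mat"
  assumes A: "A \<in> carrier_mat n n" and sym: "transpose_mat A = A"
  obtains es where "char_poly A = (\<Prod>e\<leftarrow>es. [:- e, 1:])" "sorted (rev es)"
proof -
  interpret poly_hom: map_poly_inj_comm_ring_hom complex_of_real ..
  let ?C = "map_mat complex_of_real A"
  have C: "?C \<in> carrier_mat n n" using A by auto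
  obtain as where cp: "char_poly ?C = (\<Prod>a\<leftarrow>as. [:- a, 1:])"
    using char_poly_factorized[OF C] by auto
  have real: "a \<in> \<real>" if "a \<in> set as" for a
  proof (rule eigenvalue_real_symmetric[OF A sym])
    show "eigenvalue ?C a"
      unfolding eigenvalue_root_char_poly[OF C] cp poly_prod_list
      using that by (auto simp: prod_list_zero_iff intro!: image_eqI[of _ _ a])
  qed
  have "map_poly complex_of_real (char_poly A) = (\<Prod>a\<leftarrow>as. [:- a, 1:])"
    using of_real_hom.char_poly_hom[OF A, where ?'a = complex] cp by simp
  also have "\<dots> = (\<Prod>a\<leftarrow>as. map_poly complex_of_real [:- Re a, 1:])"
    using real by (intro arg_cong[where f = prod_list] map_cong) (auto simp: of_real_Re)
  also have "\<dots> = map_poly complex_of_real (\<Prod>a\<leftarrow>as. [:- Re a, 1:])"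
    by (induction as) (simp_all add: poly_hom.hom_mult del: mult_pCons_left)
  finally have "char_poly A = (\<Prod>e\<leftarrow>map Re as. [:- e, 1:])"
    by (simp add: o_def)
  \<comment> \<open>Permuting the factors is harmless. The nonincreasing order is the one that an
    SVD prescribes.\<close>
  also have "\<dots> = (\<Prod>e\<leftarrow>rev (sort (map Re as)). [:- e, 1:])"
    by (simp only: prod_mset_prod_list[symmetric] mset_map mset_rev mset_sort)
  finally show ?thesis by (rule that) simp
qed

text \<open>Gram-Schmidt, started on a basis whose head is \<open>v\<close>, leaves \<open>v\<close>
  in place; normalizing the vectors only rescales it by some \<open>c\<close>.\<close>

lemma orthogonal_completion:
  fixes v :: "real vec"
  assumes v: "v \<in> carrier_vec n" "v \<noteq> 0\<^sub>v n"
  obtains W c where "real_orthogonal_mat n W" "col W 0 = c \<cdot>\<^sub>v v"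
proof -
  interpret cof_vec_space n "TYPE(real)" .
  define ws where "ws = gram_schmidt n (basis_completion v)"
  note b = basis_completion[OF v]
  note ws = gram_schmidt_result[OF b(2,4,5) ws_def, unfolded b(6)]
  have n: "n > 0" using v by (cases n) auto
  obtain vs where "basis_completion v = v # vs" 
    using b(6,7) n by (cases "basis_completion v") auto
  then have hd: "ws ! 0 = v" 
    using gram_schmidt_hd[OF v(1), of vs] ws n unfolding ws_def by (metis hd_conv_nth length_greater_0_conv)
  define W where "W = mat_of_cols n (map (\<lambda>w. (1 / sqrt (w \<bullet> w)) \<cdot>\<^sub>v w) ws)"
  have W: "W \<in> carrier_mat n n" unfolding W_def using ws by auto
  have wsi: "ws ! i \<in> carrier_vec n" if "i < n" for i using ws that by auto
  have colW: "col W i = (1 / sqrt (ws ! i \<bullet> ws ! i)) \<cdot>\<^sub>v (ws ! i)" if "i < n" for i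
    unfolding W_def using ws that wsi by (subst col_mat_of_cols) auto
  have "transpose_mat W * W = 1\<^sub>m n"
  proof (rule eq_matI)
    fix i j assume "i < dim_row (1\<^sub>m n :: real mat)" "j < dim_col (1\<^sub>m n :: real mat)"
    then have ij: "i < n" "j < n" by auto
    \<comment> \<open>Conjugation is trivial over the reals. The case \<open>i = j\<close> shows
      that the norms divided by are nonzero.\<close>
    have o: "(ws ! i \<bullet> ws ! j = 0) = (i \<noteq> j)"
      using corthogonalD[of ws i j] ws ij by simp
    have pos: "ws ! i \<bullet> ws ! i \<ge> 0"
      using conjugate_square_ge_0_vec[of "ws ! i"] by simp
    have "(transpose_mat W * W) $$ (i, j) = col W i \<bullet> col W j"
      using W ij by auto
    also have "\<dots> = (ws ! i \<bullet> ws ! j) / (sqrt (ws ! i \<bullet> ws ! i) * sqrt (ws ! j \<bullet> ws ! j))"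
      using wsi[OF ij(1)] wsi[OF ij(2)] 
      by (simp add: colW ij smult_scalar_prod_distrib[where n = n] scalar_prod_smult_distrib[where n = n])
    also have "\<dots> = (if i = j then 1 else 0)"
      using o pos by (auto simp: field_simps)
    finally show "(transpose_mat W * W) $$ (i, j) = 1\<^sub>m n $$ (i, j)" using ij by simp
  qed (use W in auto)
  then have "real_orthogonal_mat n W" by (rule real_orthogonal_matI[OF W])
  then show ?thesis using that colW[OF n] hd by blast
qed

text \<open>Deflation: an eigenvector for the head of \<open>es\<close> splits off a 1 by 1 block,
  and the induction hypothesis treats the rest. Since \<open>es\<close> is given, it fixes the order
  of the diagonal entries.\<close>

lemma real_symmetric_diagonalization:
  fixes A :: "real mat"
  assumes "A \<in> carrier_mat n n" "transpose_mat A = A" "char_poly A = (\<Prod>e\<leftarrow>es. [:- e, 1:])"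
  shows "\<exists>Q. real_orthogonal_mat n Q \<and> transpose_mat Q * A * Q = mat_diag n (\<lambda>i. es ! i)"
  using assms
proof (induction es arbitrary: n A)
  case Nil
  then have "n = 0" using degree_monic_char_poly[of A n] by simp
  then show ?case
    using Nil by (intro exI[of _ "1\<^sub>m 0"]) (auto simp: real_orthogonal_mat_def mat_diag_def intro!: eq_matI)
next
  case (Cons e es)
  note A = Cons.prems(1) and sym = Cons.prems(2)
  have cp: "char_poly A = [:- e, 1:] * (\<Prod>e\<leftarrow>es. [:- e, 1:])" using Cons.prems by simp
  \<comment> \<open>The degree is the dimension, so a nonempty list of roots leaves room for a first
    row and column.\<close>
  have "degree (char_poly A) \<noteq> 0" 
  proof -
    have "(\<Prod>e\<leftarrow>es. [:- e, 1:]) \<noteq> (0 :: real poly)" by (auto simp: prod_list_zero_iff)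
    then show ?thesis unfolding cp by (subst degree_mult_eq) auto
  qed
  then have "n \<noteq> 0" using degree_monic_char_poly[OF A] by simp
  then obtain m where n: "n = Suc m" by (cases n) auto
  have "eigenvalue A e" unfolding eigenvalue_root_char_poly[OF A] cp by simp
  then obtain v where v: "v \<in> carrier_vec n" "v \<noteq> 0\<^sub>v n" and Av: "A *\<^sub>v v = e \<cdot>\<^sub>v v"
    using A unfolding eigenvalue_def eigenvector_def by auto
  obtain W c where Wo: "real_orthogonal_mat n W" and W0: "col W 0 = c \<cdot>\<^sub>v v"
    using orthogonal_completion[OF v] .
  note W = real_orthogonal_matD[OF Wo]
  define A' where "A' = transpose_mat W * A * W"
  have A': "A' \<in> carrier_mat n n" unfolding A'_def using W A by auto
  have symA': "transpose_mat A' = A'"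
  proof -
    have "transpose_mat A' = transpose_mat W * transpose_mat (transpose_mat W * A)"
      unfolding A'_def using W A by (intro transpose_mult) auto
    also have "transpose_mat (transpose_mat W * A) = A * W"
      using W A sym transpose_mult[of "transpose_mat W" n n A n] by simp
    also have "transpose_mat W * (A * W) = A'"
      unfolding A'_def using W A by (intro assoc_mult_mat[symmetric]) auto
    finally show ?thesis .
  qed
  \<comment> \<open>The first column of \<open>W\<close> is a multiple of the eigenvector
    \<open>v\<close>, so \<open>A\<close> scales it by \<open>e\<close>, and the orthonormal columns
    of \<open>W\<close> turn it into a multiple of the first unit vector.\<close>
  have col0: "A' $$ (i, 0) = (if i = 0 then e else 0)" if "i < n" for i
  proof -
    have "A' = transpose_mat W * (A * W)"
      unfolding A'_def using W A by (intro assoc_mult_mat) auto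
    then have "A' $$ (i, 0) = col W i \<bullet> (A *\<^sub>v col W 0)"
      using W A that n by auto
    also have "A *\<^sub>v col W 0 = e \<cdot>\<^sub>v col W 0"
      unfolding W0 using v A Av by (simp add: mult_mat_vec smult_smult_assoc mult.commute)
    also have "col W i \<bullet> (e \<cdot>\<^sub>v col W 0) = e * (transpose_mat W * W) $$ (i, 0)"
      using W(1) that n by simp
    also have "transpose_mat W * W = 1\<^sub>m n" by (fact W)
    finally show ?thesis using that n by simp
  qed
  have row0: "A' $$ (0, i) = (if i = 0 then e else 0)" if "i < n" for i
    using col0[OF that] symA' A' that n by (metis carrier_matD index_transpose_mat(1) zero_less_Suc)
  define A3 where "A3 = mat m m (\<lambda>(i, j). A' $$ (Suc i, Suc j))"
  define A1 where "A1 = mat 1 1 (\<lambda>_. e)"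
  have A1: "A1 \<in> carrier_mat 1 1" and A3: "A3 \<in> carrier_mat m m"
    unfolding A1_def A3_def by auto
  have block: "A' = four_block_mat A1 (0\<^sub>m 1 m) (0\<^sub>m m 1) A3"
    using A' n row0 col0 by (intro eq_matI) (auto simp: A1_def A3_def)
  have symA3: "transpose_mat A3 = A3"
  proof (rule eq_matI)
    fix i j assume "i < dim_row A3" "j < dim_col A3"
    then have "i < m" "j < m" unfolding A3_def by auto
    then show "transpose_mat A3 $$ (i, j) = A3 $$ (i, j)"
      using symA' A' n by (auto simp: A3_def) (metis Suc_mono carrier_matD index_transpose_mat(1))
  qed (auto simp: A3_def)
  \<comment> \<open>Similarity preserves the characteristic polynomial. Cancelling the factor of the
    block \<open>A1\<close> leaves the product over the remaining roots for
    \<open>A3\<close>.\<close>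
  have "similar_mat_wit A' A (transpose_mat W) W"
    by (rule similar_mat_witI[of _ _ n]) (use W A A' in \<open>auto simp: A'_def\<close>)
  then have "similar_mat A' A" unfolding similar_mat_def by blast
  then have "char_poly A' = char_poly A" by (rule char_poly_similar)
  moreover have "char_poly A' = char_poly A1 * char_poly A3"
    unfolding block by (rule char_poly_four_block_zeros_col[OF A1 _ A3]) simp
  ultimately have "char_poly A1 * char_poly A3 = [:- e, 1:] * (\<Prod>e\<leftarrow>es. [:- e, 1:])"
    using cp by metis
  moreover have "char_poly A1 = [:- e, 1:]"
    by (simp add: A1_def char_poly_defs det_def sign_def)
  ultimately have "char_poly A3 = (\<Prod>e\<leftarrow>es. [:- e, 1:])"
    by (metis mult_cancel_left pCons_eq_0_iff zero_neq_one)
  from Cons.IH[OF A3 symA3 this] obtain Q where Qo: "real_orthogonal_mat m Q"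
    and diag: "transpose_mat Q * A3 * Q = mat_diag m (\<lambda>i. es ! i)" by blast
  note Q = real_orthogonal_matD[OF Qo]
  \<comment> \<open>\<open>P\<close> fixes the first coordinate and acts as \<open>Q\<close> on the
    others; \<open>W * P\<close> is the required orthogonal matrix.\<close>
  define P where "P = four_block_mat (1\<^sub>m 1) (0\<^sub>m 1 m) (0\<^sub>m m 1) Q"
  have P: "P \<in> carrier_mat n n" unfolding P_def n using Q by auto
  have PT: "transpose_mat P = four_block_mat (1\<^sub>m 1) (0\<^sub>m 1 m) (0\<^sub>m m 1) (transpose_mat Q)"
    unfolding P_def using Q by (subst transpose_four_block_mat[of _ 1 1 _ m _ m]) auto
  have "transpose_mat P * P = four_block_mat (1\<^sub>m 1) (0\<^sub>m 1 m) (0\<^sub>m m 1) (transpose_mat Q * Q)"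
    unfolding PT unfolding P_def using Q(1) by (subst mult_four_block_mat[of _ 1 1 _ m _ m _ _ 1 _ m]) auto
  then have "transpose_mat P * P = 1\<^sub>m n" using Q n by simp
  then have Po: "real_orthogonal_mat n P" by (rule real_orthogonal_matI[OF P])
  have "transpose_mat P * A' = four_block_mat A1 (0\<^sub>m 1 m) (0\<^sub>m m 1) (transpose_mat Q * A3)"
    unfolding PT block using Q(1) A3 A1 by (subst mult_four_block_mat[of _ 1 1 _ m _ m _ _ 1 _ m]) auto
  then have "transpose_mat P * A' * P = four_block_mat A1 (0\<^sub>m 1 m) (0\<^sub>m m 1) (mat_diag m (\<lambda>i. es ! i))"
    unfolding P_def diag[symmetric] using Q(1) A3 A1
    by (simp, subst mult_four_block_mat[of _ 1 1 _ m _ m _ _ 1 _ m]) auto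
  also have "\<dots> = mat_diag n (\<lambda>i. (e # es) ! i)"
    unfolding n by (intro eq_matI) (auto simp: A1_def mat_diag_def)
  finally have PAP: "transpose_mat P * A' * P = mat_diag n (\<lambda>i. (e # es) ! i)" .
  have "transpose_mat (W * P) * A * (W * P) = transpose_mat P * A' * P"
  proof -
    have "transpose_mat (W * P) * A * (W * P) = transpose_mat P * transpose_mat W * A * (W * P)"
      using transpose_mult[OF W(1) P] by simp
    also have "\<dots> = transpose_mat P * (transpose_mat W * A * W) * P"
      using W(1) P A by (simp add: assoc_mult_mat[where ?n\<^sub>1 = n and ?n\<^sub>2 = n and ?n\<^sub>3 = n and ?n\<^sub>4 = n])
    finally show ?thesis unfolding A'_def .
  qed
  then show ?case using PAP real_orthogonal_mat_mult[OF Wo Po] by metis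
qed

text \<open>Each eigenvalue is the value of the quadratic form at a column of \<open>Q\<close>,
  hence nonnegative. With sorted eigenvalues this decomposition is already an SVD with equal left
  and right factors.\<close>

lemma real_psd_diagonalization:
  fixes A :: "real mat"
  assumes A: "A \<in> carrier_mat n n" and sym: "transpose_mat A = A"
    and psd: "\<And>x. x \<in> carrier_vec n \<Longrightarrow> 0 \<le> x \<bullet> (A *\<^sub>v x)"
  obtains Q d where "real_orthogonal_mat n Q" "A = Q * mat_diag n d * transpose_mat Q"
    "\<And>i. i < n \<Longrightarrow> 0 \<le> d i" "\<And>i j. i \<le> j \<Longrightarrow> j < n \<Longrightarrow> d j \<le> d i"
proof -
  obtain es where cp: "char_poly A = (\<Prod>e\<leftarrow>es. [:- e, 1:])" and sorted: "sorted (rev es)"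
    using char_poly_real_symmetric_splits[OF A sym] .
  have len: "length es = n"
    using degree_monic_char_poly[OF A] unfolding cp by (simp add: degree_linear_factors)
  obtain Q where Qo: "real_orthogonal_mat n Q"
    and D: "transpose_mat Q * A * Q = mat_diag n (\<lambda>i. es ! i)"
    using real_symmetric_diagonalization[OF A sym cp] by blast
  note Q = real_orthogonal_matD[OF Qo]
  note assoc = assoc_mult_mat[where ?n\<^sub>1 = n and ?n\<^sub>2 = n and ?n\<^sub>3 = n and ?n\<^sub>4 = n]
  have "Q * mat_diag n (\<lambda>i. es ! i) * transpose_mat Q
      = (Q * transpose_mat Q) * A * (Q * transpose_mat Q)"
    unfolding D[symmetric] using Q(1) A by (simp add: assoc)
  also have "\<dots> = A" using Q A by simp
  finally have AQ: "A = Q * mat_diag n (\<lambda>i. es ! i) * transpose_mat Q" by simp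
  have nonneg: "0 \<le> es ! i" if i: "i < n" for i
  proof -
    have "es ! i = (transpose_mat Q * A * Q) $$ (i, i)"
      unfolding D using i by (simp add: mat_diag_def)
    also have "transpose_mat Q * A * Q = transpose_mat Q * (A * Q)"
      using Q(1) A by (simp add: assoc)
    also have "\<dots> $$ (i, i) = col Q i \<bullet> (A *\<^sub>v col Q i)"
      using Q(1) A i by simp
    also have "\<dots> \<ge> 0" using Q(1) i by (intro psd) auto
    finally show ?thesis .
  qed
  have "es ! j \<le> es ! i" if "i \<le> j" "j < n" for i j
    using sorted_rev_nth_mono[OF sorted] that len by simp
  with that[OF Qo AQ] nonneg show ?thesis by blast
qed

section \<open>Singular values and the characteristic polynomial\<close>

text \<open>The characteristic polynomial is the product of the factors \<open>[:- d i, 1:]\<close>,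
  and orders add up over a product.\<close>

lemma order_char_poly_mat_diag:
  fixes d :: "nat \<Rightarrow> 'a :: field"
  shows "Polynomial.order a (char_poly (mat_diag n d)) = card {i. i < n \<and> d i = a}"
proof -
  have "char_poly (mat_diag n d) = (\<Prod>e\<leftarrow>diag_mat (mat_diag n d). [:- e, 1:])"
    by (rule char_poly_upper_triangular[of _ n]) (auto simp: mat_diag_def)
  also have "diag_mat (mat_diag n d) = map d [0..<n]"
    by (simp add: diag_mat_def mat_diag_def)
  finally have cp: "char_poly (mat_diag n d) = (\<Prod>i\<leftarrow>[0..<n]. [:- d i, 1:])"
    by (simp add: o_def)
  have "Polynomial.order a (\<Prod>i\<leftarrow>[0..<n]. [:- d i, 1:]) = card {i. i < n \<and> d i = a}"
  proof (induction n)
    case (Suc n)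
    have nz: "(\<Prod>i\<leftarrow>[0..<n]. [:- d i, 1:]) \<noteq> 0" by (auto simp: prod_list_zero_iff)
    have "Polynomial.order a [:- d n, 1:] = (if d n = a then 1 else 0)"
      using order_power_n_n[of a 1] by (auto intro: order_0I)
    moreover have "{i. i < Suc n \<and> d i = a} = {i. i < n \<and> d i = a} \<union> (if d n = a then {n} else {})"
      by (auto simp: less_Suc_eq)
    ultimately show ?case using Suc nz by (simp add: order_mult del: mult_pCons_right mult_pCons_left)
  qed simp
  then show ?thesis using cp by simp
qed

lemma downward_closed_eq_lessThan_card:
  fixes Z :: "nat set"
  assumes "finite Z" "\<And>i j. i \<le> j \<Longrightarrow> j \<in> Z \<Longrightarrow> i \<in> Z"
  shows "Z = {..<card Z}"
proof (cases "Z = {}")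
  case False
  have "Z = {..Max Z}"
  proof (intro equalityI subsetI)
    show "i \<in> Z" if "i \<in> {..Max Z}" for i
      using assms(2)[OF _ Max_in[OF assms(1) False]] that by simp
  qed (use assms(1) in simp)
  then have "card Z = Suc (Max Z)" by (metis card_atMost)
  with \<open>Z = {..Max Z}\<close> show ?thesis by (simp add: lessThan_Suc_atMost)
qed simp

text \<open>\<open>A\<^sup>T A\<close> is similar to the diagonal matrix of the squared singular
  values, so the order of its root 0 counts the vanishing ones. The right-hand side mentions only
  \<open>A\<close>, which makes the set independent of the SVD.\<close>

lemma nonzero_singular_values_eq:
  assumes A: "A \<in> carrier_mat n n" and svd: "is_matrix_svd A U S V"
  shows "{i. i < n \<and> S $$ (i, i) \<noteq> 0} = {..<n - Polynomial.order 0 (char_poly (transpose_mat A * A))}"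
proof -
  define d where "d i = S $$ (i, i)" for i
  have dims: "dim_row A = n" "dim_col A = n" using A by auto
  note svd = svd[unfolded is_matrix_svd_def dims min.idem]
  have "real_orthogonal_mat n U" "real_orthogonal_mat n V" using svd by blast+
  then have Uc: "U \<in> carrier_mat n n" and Vc: "V \<in> carrier_mat n n"
    and U: "transpose_mat U * U = 1\<^sub>m n"
    and V: "transpose_mat V * V = 1\<^sub>m n" "V * transpose_mat V = 1\<^sub>m n"
    by (auto dest: real_orthogonal_matD)
  have "S \<in> carrier_mat n n" "diagonal_mat S" using svd by blast+
  then have S: "S = mat_diag n d"
    by (intro eq_matI) (auto simp: mat_diag_def d_def diagonal_mat_def)
  have d: "0 \<le> d i" "i \<le> j \<Longrightarrow> d j \<le> d i" if "j < n" "i < n" for i j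
    using svd that unfolding d_def by blast+
  have TS: "transpose_mat (mat_diag n d) = mat_diag n d"
    by (intro eq_matI) (auto simp: mat_diag_def)
  note assoc = assoc_mult_mat[where ?n\<^sub>1 = n and ?n\<^sub>2 = n and ?n\<^sub>3 = n and ?n\<^sub>4 = n]
  have AE: "A = U * mat_diag n d * transpose_mat V" using svd S by blast
  have TA: "transpose_mat A = V * mat_diag n d * transpose_mat U"
  proof -
    have "transpose_mat A = V * transpose_mat (U * mat_diag n d)"
      unfolding AE using Uc Vc transpose_mult[of "U * mat_diag n d" n n "transpose_mat V" n] by simp
    also have "transpose_mat (U * mat_diag n d) = mat_diag n d * transpose_mat U"
      using Uc TS transpose_mult[of U n n "mat_diag n d" n] by simp
    finally show ?thesis using Uc Vc by (simp add: assoc)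
  qed
  have "transpose_mat A * A
      = V * mat_diag n d * (transpose_mat U * U) * mat_diag n d * transpose_mat V"
    unfolding TA unfolding AE using Uc Vc by (simp add: assoc mult_carrier_mat[of _ n n _ n])
  also have "\<dots> = V * (mat_diag n d * mat_diag n d) * transpose_mat V"
  proof -
    have "V * mat_diag n d * (transpose_mat U * U) = V * mat_diag n d"
      unfolding U using Vc by (intro right_mult_one_mat[of _ n n]) auto
    then show ?thesis using Vc by (simp add: assoc mult_carrier_mat[of _ n n _ n] del: mat_diag_diag)
  qed
  also have "mat_diag n d * mat_diag n d = mat_diag n (\<lambda>i. (d i)\<^sup>2)"
    by (simp add: mat_diag_diag power2_eq_square)
  finally have "similar_mat_wit (transpose_mat A * A) (mat_diag n (\<lambda>i. (d i)\<^sup>2)) V (transpose_mat V)"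
    using V Vc A by (intro similar_mat_witI[of _ _ n]) auto
  then have "char_poly (transpose_mat A * A) = char_poly (mat_diag n (\<lambda>i. (d i)\<^sup>2))"
    by (intro char_poly_similar) (auto simp: similar_mat_def)
  then have ord: "Polynomial.order 0 (char_poly (transpose_mat A * A)) = card {i. i < n \<and> d i = 0}"
    by (simp add: order_char_poly_mat_diag)
  have "{i. i < n \<and> d i \<noteq> 0} = {..<n} - {i. i < n \<and> d i = 0}" by auto
  then have "card {i. i < n \<and> d i \<noteq> 0} = n - card {i. i < n \<and> d i = 0}"
    by (simp add: card_Diff_subset subset_eq)
  \<comment> \<open>Nonnegative and nonincreasing: whatever precedes a nonzero singular value is
    nonzero too.\<close>
  moreover have "{i. i < n \<and> d i \<noteq> 0} = {..<card {i. i < n \<and> d i \<noteq> 0}}"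
  proof (rule downward_closed_eq_lessThan_card)
    fix i j assume "i \<le> j" "j \<in> {i. i < n \<and> d i \<noteq> 0}"
    moreover from this have "0 \<le> d j" "d j \<le> d i" using d[of j i] d[of j j] by auto
    ultimately show "i \<in> {i. i < n \<and> d i \<noteq> 0}" by auto
  qed simp
  ultimately show ?thesis using ord unfolding d_def by simp
qed

section \<open>Transformed frontal slices\<close>

definition hat_slice :: "real^'k::finite^'k \<Rightarrow> 'k tensor \<Rightarrow> 'k \<Rightarrow> real mat" where
  "hat_slice M A k = frontal_slice (hat M A) k"

text \<open>The inverse transform for orthogonal \<open>M\<close>, whose inverse is its transpose.
  It builds tensors with prescribed transformed slices.\<close>

definition of_hat_slices :: "real^'k::finite^'k \<Rightarrow> nat \<Rightarrow> nat \<Rightarrow> ('k \<Rightarrow> real mat) \<Rightarrow> 'k tensor" where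
  "of_hat_slices M n m C =
     Matrix.mat n m (\<lambda>(i, j). Finite_Cartesian_Product.transpose M *v vec_lambda (\<lambda>k. C k $$ (i, j)))"

lemma dim_hat_slice [simp]:
  "dim_row (hat_slice M A k) = dim_row A" "dim_col (hat_slice M A k) = dim_col A"
  by (simp_all add: hat_slice_def frontal_slice_def hat_def)

lemma hat_slice_carrier [simp]:
  "hat_slice M A k \<in> carrier_mat n m \<longleftrightarrow> A \<in> carrier_mat n m"
  unfolding carrier_mat_def by simp

lemma hat_slice_index:
  assumes "i < dim_row A" "j < dim_col A"
  shows "hat_slice M A k $$ (i, j) = vec_nth (M *v (A $$ (i, j))) k"
  using assms by (simp add: hat_slice_def frontal_slice_def hat_def)

lemma of_hat_slices_carrier [simp]: "of_hat_slices M n m C \<in> carrier_mat n m"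
  by (simp add: of_hat_slices_def)

lemma dim_star_mult [simp]:
  "dim_row (star_mult M A B) = dim_row A" "dim_col (star_mult M A B) = dim_col B"
  by (simp_all add: star_mult_def)

lemma hat_slice_transpose [simp]: "hat_slice M (transpose_mat A) k = transpose_mat (hat_slice M A k)"
  by (intro eq_matI) (auto simp: hat_slice_index)

lemma orthogonal_matrix_transpose_mult_vec:
  assumes "orthogonal_matrix (M :: real^'k^'k)"
  shows "Finite_Cartesian_Product.transpose M *v (M *v a) = a"
    and "M *v (Finite_Cartesian_Product.transpose M *v a) = a"
  using assms by (simp_all add: orthogonal_matrix_def matrix_vector_mul_assoc del: transpose_matrix_vector)

text \<open>The outer \<open>M\<close> cancels \<open>matrix_inv M\<close>, and what remains is a
  diagonal matrix acting entrywise.\<close>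

lemma hat_tube_mult:
  assumes "orthogonal_matrix (M :: real^'k^'k)"
  shows "vec_nth (M *v tube_mult M a b) k = vec_nth (M *v a) k * vec_nth (M *v b) k"
proof -
  have "\<exists>N. M ** N = Finite_Cartesian_Product.mat 1 \<and> N ** M = Finite_Cartesian_Product.mat 1"
    using assms by (auto simp: orthogonal_matrix_def)
  then have "M ** matrix_inv M = Finite_Cartesian_Product.mat 1"
    unfolding matrix_inv_def by (rule someI2_ex) blast
  then have "M *v tube_mult M a b = tube_diag (M *v a) *v (M *v b)"
    unfolding tube_mult_def by (simp add: matrix_vector_mul_assoc matrix_mul_assoc)
  moreover have "vec_nth (tube_diag u *v w) k = vec_nth u k * vec_nth w k" for u w :: "real^'k"
    by (simp add: matrix_vector_mult_def tube_diag_def if_distrib if_distribR cong: if_cong)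
  ultimately show ?thesis by simp
qed

lemma hat_slice_star_mult:
  assumes "orthogonal_matrix (M :: real^'k^'k)" "dim_col A = dim_row B"
  shows "hat_slice M (star_mult M A B) k = hat_slice M A k * hat_slice M B k"
proof (rule eq_matI)
  fix i j assume "i < dim_row (hat_slice M A k * hat_slice M B k)"
    "j < dim_col (hat_slice M A k * hat_slice M B k)"
  then have ij: "i < dim_row A" "j < dim_col B" by auto
  have "hat_slice M (star_mult M A B) k $$ (i, j)
      = vec_nth (M *v (\<Sum>l<dim_col A. tube_mult M (A $$ (i, l)) (B $$ (l, j)))) k"
    using ij by (subst hat_slice_index) (auto simp: star_mult_def)
  also have "\<dots> = (\<Sum>l<dim_col A. vec_nth (M *v tube_mult M (A $$ (i, l)) (B $$ (l, j))) k)"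
    by (simp add: linear_sum[OF matrix_vector_mul_linear] o_def)
  also have "\<dots> = (\<Sum>l<dim_col A. hat_slice M A k $$ (i, l) * hat_slice M B k $$ (l, j))"
    using ij assms(2) by (intro sum.cong) (auto simp: hat_slice_index hat_tube_mult[OF assms(1)])
  also have "\<dots> = (hat_slice M A k * hat_slice M B k) $$ (i, j)"
    using ij assms(2) by (simp add: scalar_prod_def atLeast0LessThan)
  finally show "hat_slice M (star_mult M A B) k $$ (i, j) = (hat_slice M A k * hat_slice M B k) $$ (i, j)" .
qed auto

lemma hat_slice_of_hat_slices:
  assumes "orthogonal_matrix (M :: real^'k^'k)" "C k \<in> carrier_mat n m"
  shows "hat_slice M (of_hat_slices M n m C) k = C k"
proof (rule eq_matI)
  fix i j assume "i < dim_row (C k)" "j < dim_col (C k)"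
  then show "hat_slice M (of_hat_slices M n m C) k $$ (i, j) = C k $$ (i, j)"
    using assms(2)
    by (auto simp: hat_slice_index of_hat_slices_def orthogonal_matrix_transpose_mult_vec[OF assms(1)] simp del: transpose_matrix_vector)
qed (use assms(2) in \<open>auto simp: of_hat_slices_def\<close>)

lemma index_eq_0_iff_hat_slices:
  assumes "orthogonal_matrix (M :: real^'k^'k)" "i < dim_row A" "j < dim_col A"
  shows "A $$ (i, j) = 0 \<longleftrightarrow> (\<forall>k. hat_slice M A k $$ (i, j) = 0)"
proof
  assume "\<forall>k. hat_slice M A k $$ (i, j) = 0"
  then have "M *v (A $$ (i, j)) = 0" using assms by (simp add: hat_slice_index Finite_Cartesian_Product.vec_eq_iff)
  then show "A $$ (i, j) = 0"
    using orthogonal_matrix_transpose_mult_vec(1)[OF assms(1), of "A $$ (i, j)"] by (simp del: transpose_matrix_vector)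
qed (use assms in \<open>simp add: hat_slice_index\<close>)

lemma tensor_eqI_hat_slices:
  assumes M: "orthogonal_matrix (M :: real^'k^'k)"
    and A: "A \<in> carrier_mat n m" and B: "B \<in> carrier_mat n m"
    and eq: "\<And>k. hat_slice M A k = hat_slice M B k"
  shows "A = B"
proof (rule eq_matI)
  fix i j assume "i < dim_row B" "j < dim_col B"
  moreover from this have "vec_nth (M *v (A $$ (i, j))) k = vec_nth (M *v (B $$ (i, j))) k" for k
    using arg_cong[OF eq, of "\<lambda>C. C $$ (i, j)" k] A B by (simp add: hat_slice_index)
  ultimately have "M *v (A $$ (i, j)) = M *v (B $$ (i, j))" by (simp add: Finite_Cartesian_Product.vec_eq_iff)
  then show "A $$ (i, j) = B $$ (i, j)"
    using orthogonal_matrix_transpose_mult_vec(1)[OF M] by metis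
qed (use A B in auto)

text \<open>An orthogonal \<open>M\<close> preserves the inner product of tubes (Parseval); the rest
  reorders the sums so that the slice index comes outermost.\<close>

lemma tensor_inner_hat_slices:
  assumes M: "orthogonal_matrix (M :: real^'k^'k)"
    and dims: "dim_row Y = dim_row X" "dim_col Y = dim_col X"
  shows "tensor_inner X Y =
    (\<Sum>k\<in>UNIV. \<Sum>j<dim_col X. col (hat_slice M X k) j \<bullet> col (hat_slice M Y k) j)"
proof -
  have "orthogonal_transformation ((*v) M)"
    using M by (simp add: orthogonal_transformation_matrix)
  then have inner: "(\<Sum>k\<in>UNIV. vec_nth a k * vec_nth b k)
      = (\<Sum>k\<in>UNIV. vec_nth (M *v a) k * vec_nth (M *v b) k)" for a b
    by (simp add: orthogonal_transformation_def inner_vec_def)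
  have "(\<Sum>k\<in>UNIV. vec_nth (X $$ (i, j)) k * vec_nth (Y $$ (i, j)) k)
      = (\<Sum>k\<in>UNIV. hat_slice M X k $$ (i, j) * hat_slice M Y k $$ (i, j))"
    if "i < dim_row X" "j < dim_col X" for i j
    using that dims inner[of "X $$ (i, j)" "Y $$ (i, j)"] by (simp add: hat_slice_index)
  then have "tensor_inner X Y = (\<Sum>i<dim_row X. \<Sum>j<dim_col X. \<Sum>k\<in>UNIV.
      hat_slice M X k $$ (i, j) * hat_slice M Y k $$ (i, j))"
    by (simp add: tensor_inner_def)
  also have "\<dots> = (\<Sum>j<dim_col X. \<Sum>i<dim_row X. \<Sum>k\<in>UNIV.
      hat_slice M X k $$ (i, j) * hat_slice M Y k $$ (i, j))"
    by (rule sum.swap)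
  also have "\<dots> = (\<Sum>j<dim_col X. \<Sum>k\<in>UNIV. \<Sum>i<dim_row X.
      hat_slice M X k $$ (i, j) * hat_slice M Y k $$ (i, j))"
    by (intro sum.cong refl sum.swap)
  also have "\<dots> = (\<Sum>k\<in>UNIV. \<Sum>j<dim_col X. \<Sum>i<dim_row X.
      hat_slice M X k $$ (i, j) * hat_slice M Y k $$ (i, j))"
    by (rule sum.swap)
  also have "\<dots> = (\<Sum>k\<in>UNIV. \<Sum>j<dim_col X. col (hat_slice M X k) j \<bullet> col (hat_slice M Y k) j)"
    using dims by (intro sum.cong refl) (simp add: scalar_prod_def atLeast0LessThan)
  finally show ?thesis .
qed

section \<open>Positive semidefiniteness slice by slice\<close>

text \<open>The quadratic form of \<open>A\<close> is the sum of those of its transformed slices.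
  Nonnegative summands give one direction; test tensors supported on a single slice give the
  other.\<close>

lemma star_psd_iff_hat_slices:
  assumes M: "orthogonal_matrix (M :: real^'k^'k)" and A: "A \<in> carrier_mat n n"
  shows "star_psd M A \<longleftrightarrow> star_symmetric A \<and>
    (\<forall>k. \<forall>x\<in>carrier_vec n. 0 \<le> x \<bullet> (hat_slice M A k *\<^sub>v x))"
proof -
  have inner: "tensor_inner X (star_mult M A X)
      = (\<Sum>k\<in>UNIV. col (hat_slice M X k) 0 \<bullet> (hat_slice M A k *\<^sub>v col (hat_slice M X k) 0))"
    if X: "X \<in> carrier_mat n 1" for X
  proof -
    have "col (hat_slice M A k * hat_slice M X k) 0 = hat_slice M A k *\<^sub>v col (hat_slice M X k) 0" for k
      using X A by (intro col_mult2[of _ n n _ 1]) auto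
    then show ?thesis
      using X A by (subst tensor_inner_hat_slices[OF M]) (auto simp: hat_slice_star_mult[OF M])
  qed
  have slices_nonneg: "0 \<le> x \<bullet> (hat_slice M A k *\<^sub>v x)"
    if psd: "\<forall>X\<in>carrier_mat n 1. 0 \<le> tensor_inner X (star_mult M A X)" and x: "x \<in> carrier_vec n" for k x
  proof -
    \<comment> \<open>Slice \<open>k\<close> of the test tensor is \<open>x\<close> and all others
      vanish, so only summand \<open>k\<close> survives.\<close>
    define C where "C l = (if l = k then mat_of_cols n [x] else 0\<^sub>m n 1)" for l :: 'k
    define X where "X = of_hat_slices M n 1 C"
    have X: "X \<in> carrier_mat n 1" unfolding X_def by simp
    have colX: "col (hat_slice M X l) 0 = (if l = k then x else 0\<^sub>v n)" for l
    proof -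
      have "hat_slice M X l = C l"
        unfolding X_def by (rule hat_slice_of_hat_slices[OF M]) (auto simp: C_def)
      then show ?thesis using x by (simp add: C_def)
    qed
    have "0 \<le> tensor_inner X (star_mult M A X)" using psd X by blast
    also have "\<dots> = (\<Sum>l\<in>UNIV. if l = k then x \<bullet> (hat_slice M A k *\<^sub>v x) else 0)"
      unfolding inner[OF X] colX using A by (intro sum.cong) auto
    finally show ?thesis by simp
  qed
  have "0 \<le> tensor_inner X (star_mult M A X)"
    if "\<forall>k. \<forall>x\<in>carrier_vec n. 0 \<le> x \<bullet> (hat_slice M A k *\<^sub>v x)" "X \<in> carrier_mat n 1" for X
    unfolding inner[OF that(2)]
  proof (intro sum_nonneg)
    show "0 \<le> col (hat_slice M X k) 0 \<bullet> (hat_slice M A k *\<^sub>v col (hat_slice M X k) 0)" for k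
      using that(1) col_dim[of "hat_slice M X k" 0] that(2) by simp
  qed
  then show ?thesis
    unfolding star_psd_def using slices_nonneg A by auto
qed

section \<open>Singular tubes and the rank\<close>

lemma is_star_svdI_hat_slices:
  assumes M: "orthogonal_matrix (M :: real^'k^'k)"
    and A: "A \<in> carrier_mat n n" "U \<in> carrier_mat n n" "S \<in> carrier_mat n n" "V \<in> carrier_mat n n"
    and svd: "\<And>k. is_matrix_svd (hat_slice M A k) (hat_slice M U k) (hat_slice M S k) (hat_slice M V k)"
  shows "is_star_svd M A U S V"
proof -
  have "A = star_mult M (star_mult M U S) (transpose_mat V)"
    by (rule tensor_eqI_hat_slices[OF M, of _ n n])
      (use A svd in \<open>auto simp: hat_slice_star_mult[OF M] is_matrix_svd_def\<close>)
  then show ?thesis using svd unfolding is_star_svd_def hat_slice_def by simp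
qed

text \<open>A tube is nonzero iff some entry of its transform is. So the index set is a union of
  initial segments, one per slice, each determined by \<open>A\<close> alone.\<close>

lemma nonzero_singular_tubes_eq:
  assumes M: "orthogonal_matrix (M :: real^'k^'k)"
    and A: "A \<in> carrier_mat n n" and svd: "is_star_svd M A U S V"
  shows "{i. i < n \<and> S $$ (i, i) \<noteq> 0} =
    (\<Union>k. {..<n - Polynomial.order 0 (char_poly (transpose_mat (hat_slice M A k) * hat_slice M A k))})"
proof -
  have svd: "is_matrix_svd (hat_slice M A k) (hat_slice M U k) (hat_slice M S k) (hat_slice M V k)" for k
    using svd unfolding is_star_svd_def hat_slice_def by blast
  have S: "S \<in> carrier_mat n n" using svd A by (simp add: is_matrix_svd_def)
  have "{i. i < n \<and> S $$ (i, i) \<noteq> 0} = (\<Union>k. {i. i < n \<and> hat_slice M S k $$ (i, i) \<noteq> 0})"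
    using S by (auto simp: index_eq_0_iff_hat_slices[OF M])
  also have "\<dots> = (\<Union>k. {..<n - Polynomial.order 0 (char_poly (transpose_mat (hat_slice M A k) * hat_slice M A k))})"
    using nonzero_singular_values_eq[OF _ svd] A by simp
  finally show ?thesis .
qed

text \<open>All SVDs share one index set, so the \<open>THE\<close> in \<open>star_rank\<close> is
  well defined once an SVD exists. A union of initial segments is again one, which locates the
  nonzero tubes and does not merely count them.\<close>

lemma nonzero_singular_tubes_eq_lessThan_star_rank:
  assumes M: "orthogonal_matrix (M :: real^'k^'k)"
    and A: "A \<in> carrier_mat n n" and svd: "is_star_svd M A U S V"
  shows "{i. i < n \<and> S $$ (i, i) \<noteq> 0} = {..<star_rank M A}"
proof -
  note tubes = nonzero_singular_tubes_eq[OF M A]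
  have min: "min (dim_row A) (dim_col A) = n" using A by simp
  have "star_rank M A = card {i. i < n \<and> S $$ (i, i) \<noteq> 0}"
    unfolding star_rank_def min
  proof (rule the_equality)
    fix r assume "\<exists>U S V. is_star_svd M A U S V \<and> r = card {i. i < n \<and> S $$ (i, i) \<noteq> 0}"
    then obtain U' S' V' where svd': "is_star_svd M A U' S' V'"
      and r: "r = card {i. i < n \<and> S' $$ (i, i) \<noteq> 0}" by blast
    show "r = card {i. i < n \<and> S $$ (i, i) \<noteq> 0}" unfolding r tubes[OF svd'] tubes[OF svd] ..
  qed (use svd in blast)
  moreover have "{i. i < n \<and> S $$ (i, i) \<noteq> 0} = {..<card {i. i < n \<and> S $$ (i, i) \<noteq> 0}}"
  proof (rule downward_closed_eq_lessThan_card)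
    fix i j assume "i \<le> j" "j \<in> {i. i < n \<and> S $$ (i, i) \<noteq> 0}"
    then show "i \<in> {i. i < n \<and> S $$ (i, i) \<noteq> 0}" unfolding tubes[OF svd] by (auto intro: le_less_trans)
  qed simp
  ultimately show ?thesis by simp
qed

section \<open>Gram products and truncated square roots\<close>

text \<open>With \<open>C\<close> the transformed slice of \<open>B\<close>, the form is the squared
  norm of \<open>C\<^sup>T x\<close>.\<close>

lemma hat_slice_star_mult_transpose_psd:
  assumes M: "orthogonal_matrix (M :: real^'k^'k)" and B: "B \<in> carrier_mat n r" and x: "x \<in> carrier_vec n"
  shows "0 \<le> x \<bullet> (hat_slice M (star_mult M B (transpose_mat B)) k *\<^sub>v x)"
proof -
  let ?C = "hat_slice M B k"
  have C: "?C \<in> carrier_mat n r" using B by simp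
  have "hat_slice M (star_mult M B (transpose_mat B)) k *\<^sub>v x = ?C *\<^sub>v (transpose_mat ?C *\<^sub>v x)"
    using C B x by (simp add: hat_slice_star_mult[OF M] assoc_mult_mat_vec[of _ n r _ n])
  also have "x \<bullet> \<dots> = (transpose_mat ?C *\<^sub>v x) \<bullet> (transpose_mat ?C *\<^sub>v x)"
    using transpose_vec_mult_scalar[OF C, of "transpose_mat ?C *\<^sub>v x" x] C x by simp
  also have "\<dots> \<ge> 0" by (simp add: scalar_prod_def sum_nonneg)
  finally show ?thesis .
qed

text \<open>Diagonal entries from index \<open>r\<close> on contribute nothing, and the earlier ones
  split into two square roots because they are nonnegative.\<close>

lemma truncated_diagonalization:
  fixes Q :: "real mat"
  assumes Q: "Q \<in> carrier_mat n n" and d: "\<And>i. i < n \<Longrightarrow> 0 \<le> d i" "\<And>i. r \<le> i \<Longrightarrow> i < n \<Longrightarrow> d i = 0"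
    and r: "r \<le> n"
  defines "B \<equiv> Matrix.mat n r (\<lambda>(i, j). Q $$ (i, j) * sqrt (d j))"
  shows "Q * mat_diag n d * transpose_mat Q = B * transpose_mat B"
proof (rule eq_matI)
  fix i j assume "i < dim_row (B * transpose_mat B)" "j < dim_col (B * transpose_mat B)"
  then have ij: "i < n" "j < n" unfolding B_def by auto
  have "(Q * mat_diag n d * transpose_mat Q) $$ (i, j) = (\<Sum>l<n. Q $$ (i, l) * d l * Q $$ (j, l))"
    using ij Q by (simp add: mat_diag_mult_right[OF Q] scalar_prod_def atLeast0LessThan)
  also have "\<dots> = (\<Sum>l<r. Q $$ (i, l) * d l * Q $$ (j, l))"
    using r d(2) by (intro sum.mono_neutral_right) auto
  also have "\<dots> = (\<Sum>l<r. (Q $$ (i, l) * sqrt (d l)) * (Q $$ (j, l) * sqrt (d l)))"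
    using r d(1) by (intro sum.cong) auto
  also have "\<dots> = (B * transpose_mat B) $$ (i, j)"
    using ij by (simp add: B_def scalar_prod_def atLeast0LessThan)
  finally show "(Q * mat_diag n d * transpose_mat Q) $$ (i, j) = (B * transpose_mat B) $$ (i, j)" .
qed (use Q in \<open>auto simp: B_def\<close>)

theorem proposition3p5:
  fixes M :: "real^'k^'k" and A :: "'k tensor" and n :: nat
  assumes "orthogonal_matrix M"
    and "A \<in> carrier_mat n n"
    and "star_symmetric A"
  shows "star_psd M A \<longleftrightarrow>
    (\<exists>B \<in> carrier_mat n (star_rank M A). A = star_mult M B (transpose_mat B))"
proof
  assume "\<exists>B \<in> carrier_mat n (star_rank M A). A = star_mult M B (transpose_mat B)"
  then obtain B where "B \<in> carrier_mat n (star_rank M A)" "A = star_mult M B (transpose_mat B)" by blast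
  then have "0 \<le> x \<bullet> (hat_slice M A k *\<^sub>v x)" if "x \<in> carrier_vec n" for x k
    using hat_slice_star_mult_transpose_psd[OF assms(1) _ that] by metis
  then show "star_psd M A" using star_psd_iff_hat_slices[OF assms(1,2)] assms(3) by blast
next
  note M = assms(1) and A = assms(2)
  assume "star_psd M A"
  then have psd: "0 \<le> x \<bullet> (hat_slice M A k *\<^sub>v x)" if "x \<in> carrier_vec n" for x k
    using star_psd_iff_hat_slices[OF M A] that by blast
  have "transpose_mat (hat_slice M A k) = hat_slice M A k" for k
    using assms(3) unfolding star_symmetric_def by (metis hat_slice_transpose)
  then have "\<exists>Q d. real_orthogonal_mat n Q \<and> hat_slice M A k = Q * mat_diag n d * transpose_mat Q \<and>
      (\<forall>i<n. 0 \<le> d i) \<and> (\<forall>i j. i \<le> j \<longrightarrow> j < n \<longrightarrow> d j \<le> d i)" for k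
    using real_psd_diagonalization[of "hat_slice M A k" n] A psd by (metis hat_slice_carrier)
  then obtain Q d where Q: "\<And>k. real_orthogonal_mat n (Q k)"
    and AQ: "\<And>k. hat_slice M A k = Q k * mat_diag n (d k) * transpose_mat (Q k)"
    and d: "\<And>k i. i < n \<Longrightarrow> 0 \<le> d k i" "\<And>k i j. i \<le> j \<Longrightarrow> j < n \<Longrightarrow> d k j \<le> d k i"
    by metis
  have Qc: "Q k \<in> carrier_mat n n" for k using real_orthogonal_matD[OF Q] by simp
  \<comment> \<open>The slicewise spectral decompositions are assembled into a tensor SVD. As the
    eigenvalues are nonnegative, \<open>U\<close> serves on both sides.\<close>
  define U where "U = of_hat_slices M n n Q"
  define S where "S = of_hat_slices M n n (\<lambda>k. mat_diag n (d k))"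
  have U: "hat_slice M U k = Q k" and S: "hat_slice M S k = mat_diag n (d k)" for k
    unfolding U_def S_def using Qc by (simp_all add: hat_slice_of_hat_slices[OF M])
  have svd: "is_star_svd M A U S U"
  proof (rule is_star_svdI_hat_slices[OF M A])
    have dims: "dim_row A = n" "dim_col A = n" using A by auto
    show "is_matrix_svd (hat_slice M A k) (hat_slice M U k) (hat_slice M S k) (hat_slice M U k)" for k
      unfolding is_matrix_svd_def dim_hat_slice dims min.idem U S
      using Q AQ d by (intro conjI) (auto simp: diagonal_mat_def mat_diag_def)
  qed (simp_all add: U_def S_def)
  define r where "r = star_rank M A"
  note rank = nonzero_singular_tubes_eq_lessThan_star_rank[OF M A svd, folded r_def]
  have r: "r \<le> n" using rank by (metis (no_types, lifting) lessThan_subset_iff lessThan_def Collect_mono_iff)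
  \<comment> \<open>From index \<open>r\<close> on, the whole tube of \<open>S\<close> vanishes,
    hence its entry in every slice at once. This allows one common width \<open>r\<close> for all
    slices.\<close>
  have d0: "d k i = 0" if "r \<le> i" "i < n" for k i
  proof -
    have "i \<notin> {i. i < n \<and> S $$ (i, i) \<noteq> 0}" unfolding rank using that by simp
    then have "S $$ (i, i) = 0" using that by blast
    then have "hat_slice M S k $$ (i, i) = 0"
      using that by (subst (asm) index_eq_0_iff_hat_slices[OF M]) (auto simp: S_def of_hat_slices_def)
    then show ?thesis using that unfolding S by (simp add: mat_diag_def)
  qed
  \<comment> \<open>The first \<open>r\<close> columns of the square-root factor
    \<open>Q\<^sub>k D\<^sub>k\<^sup>1\<^sup>/\<^sup>2\<close>; the dropped columns are zero by
    \<open>d0\<close>.\<close>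
  define C where "C k = Matrix.mat n r (\<lambda>(i, j). Q k $$ (i, j) * sqrt (d k j))" for k
  define B where "B = of_hat_slices M n r C"
  have Bc: "B \<in> carrier_mat n r" unfolding B_def by simp
  have B: "hat_slice M B k = C k" for k
    unfolding B_def by (rule hat_slice_of_hat_slices[OF M]) (simp add: C_def)
  have "A = star_mult M B (transpose_mat B)"
  proof (rule tensor_eqI_hat_slices[OF M A])
    show "hat_slice M A k = hat_slice M (star_mult M B (transpose_mat B)) k" for k
      using truncated_diagonalization[OF Qc d(1) d0 r] AQ B Bc
      by (simp add: hat_slice_star_mult[OF M] C_def)
  qed (use Bc in auto)
  then show "\<exists>B \<in> carrier_mat n (star_rank M A). A = star_mult M B (transpose_mat B)"
    using Bc unfolding r_def by blast
qed

end
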